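(* Let $\mathcal{T}=(t_n)_{n=0}^\infty$ be the Thue-Morse sequence over $\mathbb{F}_2$, i.e. $t_n \equiv s_1(n) \bmod 2$, where $s_1(n)$ is the number of ones in the binary expansion of the nonnegative integer $n$. Let $\mathcal{T}'=(t_{i^2})_{i=0}^\infty$ be its subsequence along the squares. Then for every integer $N\ge 21$, the $N$th maximum order complexity of $\mathcal{T}'$ satisfies $$M(\mathcal{T}',N)\ge \sqrt{\frac{2N}{5}}.$$
   Context: For a positive integer $N$ and a sequence $\mathcal{S}=(s_i)_{i=0}^\infty$ over $\mathbb{F}_2$ with $(s_0,\ldots,s_{N-2})$ not constant, the $N$th maximum order complexity $M(\mathcal{S},N)$ is the smallest positive integer $M$ such that there is a polynomial $f\in\mathbb{F}_2[x_1,\ldots,x_M]$ with $s_{i+M}=f(s_i,s_{i+1},\ldots,s_{i+M-1})$ for all $0\le i\le N-M-1$. If $s_i=a$ for all $i=0,\ldots,N-2$, then $M(\mathcal{S},N)=0$ if $s_{N-1}=a$ and $M(\mathcal{S},N)=N-1$ if $s_{N-1}\ne a$. *)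

theory Defs
  imports Complex_Main "HOL-Library.Z2" "HOL-Library.Poly_Mapping"
begin

text \<open>
  A multivariate polynomial over \<open>'a\<close> in the indeterminates \<open>x\<^sub>0, x\<^sub>1, \<dots>\<close> is a finitely
  supported map from exponent vectors (themselves finitely supported) to coefficients.
\<close>

type_synonym 'a mvpoly = "(nat \<Rightarrow>\<^sub>0 nat) \<Rightarrow>\<^sub>0 'a"

definition mv_vars :: "'a::zero mvpoly \<Rightarrow> nat set" where
  "mv_vars f = (\<Union>m \<in> Poly_Mapping.keys f. Poly_Mapping.keys m)"

definition mv_eval :: "'a::comm_semiring_1 mvpoly \<Rightarrow> (nat \<Rightarrow> 'a) \<Rightarrow> 'a" where
  "mv_eval f x =
     (\<Sum>m \<in> Poly_Mapping.keys f. Poly_Mapping.lookup f m *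
        (\<Prod>j \<in> Poly_Mapping.keys m. x j ^ Poly_Mapping.lookup m j))"

text \<open>
  The binary field is the type \<^typ>\<open>bit\<close>. The polynomial \<open>f\<close> lies in
  \<open>F\<^sub>2[x\<^sub>1, \<dots>, x\<^sub>M]\<close>, and \<open>x\<^sub>j\<close> receives the value \<open>s (i + j - 1)\<close>; the truncated
  subtraction is harmless because only \<open>j \<ge> 1\<close> occurs. The range \<open>i + M < N\<close> is
  \<open>0 \<le> i \<le> N - M - 1\<close> without truncation.
\<close>

definition has_recurrence :: "(nat \<Rightarrow> bit) \<Rightarrow> nat \<Rightarrow> nat \<Rightarrow> bool" where
  "has_recurrence s N M \<longleftrightarrow>
     (\<exists>f :: bit mvpoly. mv_vars f \<subseteq> {1..M} \<and>
        (\<forall>i. i + M < N \<longrightarrow> s (i + M) = mv_eval f (\<lambda>j. s (i + j - 1))))"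

text \<open>
  Intended for \<open>N \<ge> 1\<close>. The first case says that \<open>s 0, \<dots>, s (N - 2)\<close> is constant, so its
  value may be read off as \<open>s 0\<close>; for \<open>N = 1\<close> this initial segment is empty and both
  alternatives give \<open>0\<close>.
\<close>

definition max_order_complexity :: "(nat \<Rightarrow> bit) \<Rightarrow> nat \<Rightarrow> nat" where
  "max_order_complexity s N =
     (if \<exists>a. \<forall>i < N - 1. s i = a
      then (if s (N - 1) = s 0 then 0 else N - 1)
      else (LEAST M. 0 < M \<and> has_recurrence s N M))"

definition binary_ones :: "nat \<Rightarrow> nat" where
  "binary_ones n = card {k. bit n k}"

definition thue_morse :: "nat \<Rightarrow> bit" where
  "thue_morse n = of_nat (binary_ones n)"

definition thue_morse_squares :: "nat \<Rightarrow> bit" where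
  "thue_morse_squares i = thue_morse (i\<^sup>2)"

end

theory Submission
  imports Defs
begin

text \<open>
  If a sequence has two equal windows of length \<open>M\<close> starting at \<open>i < j\<close>, a recurrence of order
  \<open>M\<close> forces it to agree at \<open>i + d\<close> and \<open>j + d\<close> for all further \<open>d\<close> in range. For the
  Thue--Morse sequence along squares take \<open>i = 2^k\<close> and \<open>j = 2^(k+1)\<close>: as long as
  \<open>d\<^sup>2 < 2^(k+1)\<close>, the three summands of \<open>(2^k + d)\<^sup>2 = d\<^sup>2 + 2^(k+1) d + 2^(2k)\<close> occupy disjoint
  blocks of binary digits, so the digit sum does not depend on \<open>k\<close>. Slightly beyond this range
  there is a \<open>d\<close> for which exactly one of the two expansions produces a carry. Hence
  \<open>M\<^sup>2 \<ge> 2^(k+1)\<close>, and \<open>k\<close> is chosen with \<open>2^(k+1)\<close> between \<open>2N/5\<close> and \<open>4N/5\<close>;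
  for small \<open>N\<close> the windows at \<open>0\<close> and \<open>3\<close> suffice.
\<close>

section \<open>Recurrences and repeated windows\<close>

lemma mv_eval_cong:
  assumes "\<And>j. j \<in> mv_vars f \<Longrightarrow> x j = y j"
  shows "mv_eval f x = mv_eval f y"
  unfolding mv_eval_def
proof (intro sum.cong refl arg_cong2[where f = times] prod.cong)
  fix m j
  assume "m \<in> Poly_Mapping.keys f" "j \<in> Poly_Mapping.keys m"
  then have "j \<in> mv_vars f"
    by (auto simp: mv_vars_def)
  then show "x j ^ Poly_Mapping.lookup m j = y j ^ Poly_Mapping.lookup m j"
    using assms by simp
qed

text \<open>No \<open>i\<close> satisfies \<open>i + N < N\<close>, so the zero polynomial will do.
  This witness makes the \<open>LEAST\<close> in \<open>max_order_complexity\<close>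
  attained.\<close>

lemma has_recurrence_self: "has_recurrence s N N"
  unfolding has_recurrence_def by (rule exI[of _ 0]) (simp add: mv_vars_def)

lemma has_recurrence_window_determines_continuation:
  assumes rec: "has_recurrence s N M"
    and window: "\<And>e. e < M \<Longrightarrow> s (i + e) = s (j + e)"
    and "i \<le> j" "j + d < N"
  shows "s (i + d) = s (j + d)"
  using \<open>j + d < N\<close>
proof (induction d rule: less_induct)
  case (less d)
  show ?case
  proof (cases "d < M")
    case True
    then show ?thesis by (rule window)
  next
    case False
    obtain f where f: "mv_vars f \<subseteq> {1..M}"
      and step: "\<And>i. i + M < N \<Longrightarrow> s (i + M) = mv_eval f (\<lambda>l. s (i + l - 1))"
      using rec unfolding has_recurrence_def by blast
    \<comment> \<open>Both terms are values of the same \<open>f\<close> on the \<open>M\<close>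
      preceding terms, at offsets \<open>d - M\<close> to \<open>d - 1\<close>, which agree by
      induction.\<close>
    have "mv_eval f (\<lambda>l. s (i + (d - M) + l - 1)) = mv_eval f (\<lambda>l. s (j + (d - M) + l - 1))"
    proof (rule mv_eval_cong)
      fix l
      assume "l \<in> mv_vars f"
      then have l: "1 \<le> l" "l \<le> M"
        using f by auto
      have "s (i + (d - M + l - 1)) = s (j + (d - M + l - 1))"
        by (rule less.IH) (use l False less.prems in linarith)+
      then show "s (i + (d - M) + l - 1) = s (j + (d - M) + l - 1)"
        using l by (simp add: add.assoc)
    qed
    then show ?thesis
      using step[of "i + (d - M)"] step[of "j + (d - M)"] False less.prems \<open>i \<le> j\<close>
      by (simp add: add.assoc)
  qed
qed

text \<open>Two distinct terms among the first \<open>N - 1\<close> exclude the constant case of the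
  definition.\<close>

lemma max_order_complexity_has_recurrence:
  assumes "s i \<noteq> s j" "i + 1 < N" "j + 1 < N"
  shows "has_recurrence s N (max_order_complexity s N)"
proof -
  have "i < N - 1" "j < N - 1"
    using assms(2,3) by auto
  then have "\<not> (\<exists>a. \<forall>i < N - 1. s i = a)"
    using assms(1) by metis
  moreover have "0 < N \<and> has_recurrence s N N"
    using assms(2) has_recurrence_self by simp
  ultimately show ?thesis
    unfolding max_order_complexity_def
    using LeastI[of "\<lambda>M. 0 < M \<and> has_recurrence s N M" N] by (simp only: if_False)
qed

section \<open>Digit blocks of the Thue--Morse sequence\<close>

lemma finite_bits_nat: "finite {k. bit (n :: nat) k}"
proof (rule finite_subset)
  show "{k. bit n k} \<subseteq> {..n}"
  proof clarsimp
    fix k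
    assume "bit n k"
    then have "2 ^ k \<le> n"
      by (metis bit_iff_odd div_less even_zero not_le)
    then show "k \<le> n"
      using less_exp[of k] by linarith
  qed
qed simp

lemma binary_ones_0 [simp]: "binary_ones 0 = 0"
  by (simp add: binary_ones_def)

lemma binary_ones_double [simp]: "binary_ones (2 * n) = binary_ones n"
proof -
  have "{k. bit (2 * n) k} = Suc ` {k. bit n k}"
  proof (intro set_eqI)
    fix k
    show "k \<in> {k. bit (2 * n) k} \<longleftrightarrow> k \<in> Suc ` {k. bit n k}"
      by (cases k) (auto simp: bit_0 bit_Suc)
  qed
  then show ?thesis
    by (simp add: binary_ones_def card_image)
qed

lemma binary_ones_Suc_double [simp]: "binary_ones (Suc (2 * n)) = Suc (binary_ones n)"
proof -
  have "{k. bit (Suc (2 * n)) k} = insert 0 (Suc ` {k. bit n k})"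
  proof (intro set_eqI)
    fix k
    show "k \<in> {k. bit (Suc (2 * n)) k} \<longleftrightarrow> k \<in> insert 0 (Suc ` {k. bit n k})"
      by (cases k) (auto simp: bit_0 bit_Suc)
  qed
  then show ?thesis
    by (simp add: binary_ones_def card_image finite_bits_nat)
qed

lemma thue_morse_0 [simp]: "thue_morse 0 = 0"
  by (simp add: thue_morse_def)

lemma thue_morse_double [simp]: "thue_morse (2 * n) = thue_morse n"
  by (simp add: thue_morse_def)

lemma thue_morse_Suc_double [simp]: "thue_morse (Suc (2 * n)) = 1 + thue_morse n"
  by (simp add: thue_morse_def)

lemma thue_morse_1 [simp]: "thue_morse (Suc 0) = 1"
  using thue_morse_Suc_double[of 0] by simp

lemma thue_morse_numeral [simp]:
  "thue_morse (numeral (Num.Bit0 w)) = thue_morse (numeral w)"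
  "thue_morse (numeral (Num.Bit1 w)) = 1 + thue_morse (numeral w)"
  using thue_morse_double[of "numeral w", unfolded mult_2]
    thue_morse_Suc_double[of "numeral w", unfolded mult_2 Suc_eq_plus1]
  by (simp_all only: numeral_Bit0 numeral_Bit1)

text \<open>The binary digits of \<open>a\<close> and of \<open>2 ^ k * b\<close> occupy disjoint
  positions; the induction peels off the last digit of \<open>a\<close>.\<close>

lemma thue_morse_append:
  assumes "a < 2 ^ k"
  shows "thue_morse (a + 2 ^ k * b) = thue_morse a + thue_morse b"
  using assms
proof (induction k arbitrary: a)
  case 0
  then show ?case by simp
next
  case (Suc k)
  define c where "c = a div 2"
  have c: "c < 2 ^ k"
    using Suc.prems by (simp add: c_def less_mult_imp_div_less mult.commute)
  have "a = 2 * c \<or> a = Suc (2 * c)"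
    by (simp add: c_def) presburger
  then show ?case
  proof
    assume a: "a = 2 * c"
    have "a + 2 ^ Suc k * b = 2 * (c + 2 ^ k * b)"
      by (simp add: a algebra_simps)
    then show ?thesis
      using Suc.IH[OF c] by (simp only: a thue_morse_double)
  next
    assume a: "a = Suc (2 * c)"
    have "a + 2 ^ Suc k * b = Suc (2 * (c + 2 ^ k * b))"
      by (simp add: a algebra_simps)
    then show ?thesis
      using Suc.IH[OF c] by (simp only: a thue_morse_Suc_double add.assoc)
  qed
qed

text \<open>With the next lemma, this strips nested digit blocks one by one: a block 1 flips the
  parity, a block 3 has two ones and keeps it. The form of the exponent guarantees room for the
  block.\<close>

lemma thue_morse_1_append: "thue_morse (1 + 2 ^ Suc k * b) = 1 + thue_morse b"
  using thue_morse_append[OF one_less_power[of 2 "Suc k"], of b] by simp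

lemma thue_morse_3_append: "thue_morse (3 + 2 ^ Suc (Suc k) * b) = thue_morse b"
proof -
  have "(1 :: nat) \<le> 2 ^ k" by simp
  then have "3 < (2 :: nat) ^ Suc (Suc k)"
    unfolding power_Suc by linarith
  then show ?thesis
    by (simp add: thue_morse_append del: power_Suc)
qed

section \<open>Windows along the squares\<close>

lemma thue_morse_squares_power_add:
  assumes "k \<ge> 3" "d\<^sup>2 < 2 ^ Suc k"
  shows "thue_morse_squares (2 ^ k + d) = thue_morse_squares d + thue_morse d + 1"
proof -
  obtain q where k: "k = q + 3"
    using assms(1) by (metis add.commute le_Suc_ex)
  \<comment> \<open>The top summand \<open>2 ^ (2 * k)\<close> sits at digit
    \<open>q + 2 = k - 1\<close> relative to \<open>2 ^ Suc k * d\<close>. That \<open>d\<close>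
    stays below it uses \<open>k + 1 \<le> 2 * (k - 1)\<close>, that is,
    \<open>k \<ge> 3\<close>.\<close>
  have "d < 2 ^ (q + 2)"
  proof (rule power_less_imp_less_base)
    have "d\<^sup>2 < 2 ^ (q + 4)"
      using assms(2) by (simp add: k power_add)
    also have "\<dots> \<le> 2 ^ (2 * (q + 2))"
      by (rule power_increasing) auto
    also have "\<dots> = ((2 :: nat) ^ (q + 2))\<^sup>2"
      by (rule power_even_eq)
    finally show "d\<^sup>2 < ((2 :: nat) ^ (q + 2))\<^sup>2" .
  qed simp
  then have "thue_morse (d + 2 ^ (q + 2) * 1) = thue_morse d + 1"
    using thue_morse_append[of d "q + 2" 1] by simp
  moreover have "(2 ^ k + d)\<^sup>2 = d\<^sup>2 + 2 ^ Suc k * (d + 2 ^ (q + 2) * 1)"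
    by (simp add: k power2_eq_square algebra_simps power_add)
  ultimately show ?thesis
    using thue_morse_append[OF assms(2), of "d + 2 ^ (q + 2) * 1"]
    by (simp add: thue_morse_squares_def add.assoc)
qed

lemma thue_morse_squares_power_windows_agree:
  assumes "k \<ge> 3" "d\<^sup>2 < 2 ^ Suc k"
  shows "thue_morse_squares (2 ^ k + d) = thue_morse_squares (2 ^ Suc k + d)"
proof -
  have "d\<^sup>2 < 2 ^ Suc (Suc k)"
    using assms(2) by simp
  then show ?thesis
    using thue_morse_squares_power_add[of k d] thue_morse_squares_power_add[of "Suc k" d] assms
    by simp
qed

text \<open>With \<open>k = 2 * q + 5\<close>, the leading one of \<open>d\<^sup>2\<close> is at
  digit \<open>k + 1\<close>, where it meets the last one of \<open>2 ^ (k + 1) * d\<close>; the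
  carry merges two ones into one. For \<open>k + 1\<close> in place of \<open>k\<close> these ones
  are adjacent and nothing carries. The nested forms list the digit blocks from the bottom
  up.\<close>

lemma thue_morse_squares_differ_odd:
  fixes q :: nat
  defines "d \<equiv> 2 ^ (q + 3) + 1"
  shows "thue_morse_squares (2 ^ (2 * q + 5) + d) \<noteq> thue_morse_squares (2 ^ (2 * q + 6) + d)"
proof -
  have "(2 ^ (2 * q + 5) + d)\<^sup>2 = 1 + 2 ^ Suc (q + 3) * (1 + 2 ^ Suc (q + 2) *
      (1 + 2 ^ Suc (q + 1) * (1 + 2 ^ Suc q * 1)))"
    by (simp add: d_def power2_eq_square algebra_simps power_add power_mult)
  then have "thue_morse_squares (2 ^ (2 * q + 5) + d) = 1"
    by (simp only: thue_morse_squares_def thue_morse_1_append) simp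
  moreover have "(2 ^ (2 * q + 6) + d)\<^sup>2 = 1 + 2 ^ Suc (q + 3) * (1 + 2 ^ Suc (q + 1) *
      (3 + 2 ^ Suc (Suc (q + 2)) * (1 + 2 ^ Suc (q + 1) * 1)))"
    by (simp add: d_def power2_eq_square algebra_simps power_add power_mult)
  then have "thue_morse_squares (2 ^ (2 * q + 6) + d) = 0"
    by (simp only: thue_morse_squares_def thue_morse_1_append thue_morse_3_append) simp
  ultimately show ?thesis by simp
qed

text \<open>Now \<open>k = 2 * q + 8\<close> and \<open>2 ^ (k + 1)\<close> is not a square, but
  \<open>9 = 8 + 1\<close> makes \<open>(3 * 2 ^ (q + 3))\<^sup>2\<close> exceed it slightly. Again
  the leading one of \<open>d\<^sup>2\<close> is at digit \<open>k + 1\<close> and collides only for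
  the smaller power.\<close>

lemma thue_morse_squares_differ_even:
  fixes q :: nat
  defines "d \<equiv> 3 * 2 ^ (q + 3) + 1"
  shows "thue_morse_squares (2 ^ (2 * q + 8) + d) \<noteq> thue_morse_squares (2 ^ (2 * q + 9) + d)"
proof -
  have "(2 ^ (2 * q + 8) + d)\<^sup>2 = 1 + 2 ^ Suc (q + 3) * (3 + 2 ^ Suc (Suc q) *
      (1 + 2 ^ Suc 3 * (1 + 2 ^ Suc (q + 1) * (3 + 2 ^ Suc (Suc (q + 2)) * 1))))"
    by (simp add: d_def power2_eq_square algebra_simps power_add power_mult)
  then have "thue_morse_squares (2 ^ (2 * q + 8) + d) = 0"
    by (simp only: thue_morse_squares_def thue_morse_1_append thue_morse_3_append) simp
  moreover have "(2 ^ (2 * q + 9) + d)\<^sup>2 = 1 + 2 ^ Suc (q + 3) * (3 + 2 ^ Suc (Suc q) *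
      (1 + 2 ^ Suc 2 * (3 + 2 ^ Suc (Suc (q + 2)) * (3 + 2 ^ Suc (Suc (q + 3)) * 1))))"
    by (simp add: d_def power2_eq_square algebra_simps power_add power_mult)
  then have "thue_morse_squares (2 ^ (2 * q + 9) + d) = 1"
    by (simp only: thue_morse_squares_def thue_morse_1_append thue_morse_3_append) simp
  ultimately show ?thesis by simp
qed

text \<open>The bound on \<open>d\<close> keeps the differing index \<open>2 ^ Suc k + d\<close>
  below \<open>5/4\<close> of \<open>2 ^ Suc k\<close>, which is where the constant of the theorem
  comes from.\<close>

lemma thue_morse_squares_power_windows_differ:
  assumes "k \<ge> 5"
  obtains d where "4 * d + 4 \<le> 2 ^ Suc k"
    and "thue_morse_squares (2 ^ k + d) \<noteq> thue_morse_squares (2 ^ Suc k + d)"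
proof -
  have pow: "1 + 2 ^ q \<le> 2 * (2 :: nat) ^ (2 * q)" for q
  proof -
    have "(2 :: nat) ^ q \<le> 2 ^ (2 * q)" "(1 :: nat) \<le> 2 ^ (2 * q)"
      by (auto intro: power_increasing)
    then show ?thesis by linarith
  qed
  consider (odd) q where "k = 2 * q + 5" | (six) "k = 6" | (even) q where "k = 2 * q + 8"
  proof (cases "even k")
    case True
    then obtain r where "k = 2 * r" by blast
    then show thesis
      using that(2) that(3)[of "r - 4"] assms by (cases "r = 3") auto
  next
    case False
    then obtain r where "k = 2 * r + 1" by (rule oddE)
    then show thesis
      using that(1)[of "r - 2"] assms by simp
  qed
  then show thesis
  proof cases
    case (odd q)
    show thesis
    proof (rule that[of "2 ^ (q + 3) + 1"])
      show "4 * (2 ^ (q + 3) + 1) + 4 \<le> (2 :: nat) ^ Suc k"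
        using pow[of q] by (simp add: odd power_add)
      have "Suc k = 2 * q + 6"
        by (simp add: odd)
      then show "thue_morse_squares (2 ^ k + (2 ^ (q + 3) + 1)) \<noteq>
          thue_morse_squares (2 ^ Suc k + (2 ^ (q + 3) + 1))"
        using thue_morse_squares_differ_odd[of q] by (simp only: odd not_False_eq_True)
    qed
  next
    case six
    show thesis
      \<comment> \<open>Here 13 is the \<open>d\<close> of the even case at \<open>q = -1\<close>,
        where the blocks 3 and 9 of \<open>d\<^sup>2\<close> overlap, so the values are computed
        directly.\<close>
      by (rule that[of 13]) (auto simp: six thue_morse_squares_def)
  next
    case (even q)
    show thesis
    proof (rule that[of "3 * 2 ^ (q + 3) + 1"])
      show "4 * (3 * 2 ^ (q + 3) + 1) + 4 \<le> (2 :: nat) ^ Suc k"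
        using pow[of q] by (simp add: even power_add)
      have "Suc k = 2 * q + 9"
        by (simp add: even)
      then show "thue_morse_squares (2 ^ k + (3 * 2 ^ (q + 3) + 1)) \<noteq>
          thue_morse_squares (2 ^ Suc k + (3 * 2 ^ (q + 3) + 1))"
        using thue_morse_squares_differ_even[of q] by (simp only: even not_False_eq_True)
    qed
  qed
qed

text \<open>The sequence starts with 011 three times, but the term at index 9 is 1 instead of
  0.\<close>

lemma has_recurrence_thue_morse_squares_ge_7:
  assumes "has_recurrence thue_morse_squares N M" "N \<ge> 10"
  shows "M \<ge> 7"
proof (rule ccontr)
  assume "\<not> M \<ge> 7"
  have "thue_morse_squares (0 + e) = thue_morse_squares (3 + e)" if "e < M" for e
  proof -
    from that \<open>\<not> M \<ge> 7\<close> have "e \<in> {0, 1, 2, 3, 4, 5}" by auto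
    then show ?thesis by (auto simp: thue_morse_squares_def)
  qed
  from has_recurrence_window_determines_continuation[OF assms(1) this, of 6] assms(2)
  show False by (simp add: thue_morse_squares_def)
qed

lemma has_recurrence_thue_morse_squares_power_le:
  assumes "has_recurrence thue_morse_squares N M" "k \<ge> 5" "5 * 2 ^ Suc k \<le> 4 * N"
  shows "2 ^ Suc k \<le> M\<^sup>2"
proof (rule ccontr)
  assume small: "\<not> 2 ^ Suc k \<le> M\<^sup>2"
  obtain d where d: "4 * d + 4 \<le> 2 ^ Suc k"
    and differ: "thue_morse_squares (2 ^ k + d) \<noteq> thue_morse_squares (2 ^ Suc k + d)"
    using thue_morse_squares_power_windows_differ[OF assms(2)] by blast
  have "thue_morse_squares (2 ^ k + e) = thue_morse_squares (2 ^ Suc k + e)" if "e < M" for e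
  proof (rule thue_morse_squares_power_windows_agree)
    have "e\<^sup>2 \<le> M\<^sup>2"
      using that by (simp add: power_mono)
    then show "e\<^sup>2 < 2 ^ Suc k"
      using small by linarith
  qed (use assms(2) in simp)
  moreover have "2 ^ Suc k + d < N"
    using d assms(3) by linarith
  ultimately show False
    using has_recurrence_window_determines_continuation[OF assms(1), of "2 ^ k" "2 ^ Suc k" d] differ
    by simp
qed

theorem theorem1:
  fixes N :: nat
  assumes "N \<ge> 21"
  shows "real (max_order_complexity thue_morse_squares N) \<ge> sqrt (2 * real N / 5)"
proof -
  define M where "M = max_order_complexity thue_morse_squares N"
  have rec: "has_recurrence thue_morse_squares N M"
    unfolding M_def
    by (rule max_order_complexity_has_recurrence[of _ 0 1])
      (use assms in \<open>auto simp: thue_morse_squares_def\<close>)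
  have "2 * N \<le> 5 * M\<^sup>2"
  \<comment> \<open>The threshold is the largest \<open>N\<close> with
    \<open>2 * N \<le> 5 * 7\<^sup>2\<close>; beyond it \<open>4 * N div 5\<close> exceeds
    \<open>2 ^ 6\<close>, which gives \<open>k \<ge> 5\<close>.\<close>
  proof (cases "N \<le> 122")
    case True
    have "7\<^sup>2 \<le> M\<^sup>2"
      using has_recurrence_thue_morse_squares_ge_7[OF rec] assms by (intro power_mono) auto
    then show ?thesis
      using True by simp
  next
    case False
    obtain K where K: "2 ^ K \<le> 4 * N div 5" "4 * N div 5 < 2 ^ (K + 1)"
    proof -
      have "1 \<le> 4 * N div 5"
        using False by linarith
      then show thesis
        using that ex_power_ivl1[of 2 "4 * N div 5"] by blast
    qed
    have "(2 :: nat) ^ 6 < 2 ^ (K + 1)"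
      using K(2) False by simp
    then have "K \<ge> 6"
      by (subst (asm) power_strict_increasing_iff) auto
    then obtain k where k: "K = Suc k" "k \<ge> 5"
      by (cases K) auto
    have "5 * 2 ^ Suc k \<le> 4 * N"
      using K(1) unfolding k(1) by linarith
    then have "2 ^ Suc k \<le> M\<^sup>2"
      using has_recurrence_thue_morse_squares_power_le[OF rec k(2)] by blast
    \<comment> \<open>Maximality of \<open>K\<close> gives \<open>4 * N < 5 * 2 ^ (k + 2)\<close>,
      and halving this leaves \<open>2 * N < 5 * 2 ^ Suc k\<close>.\<close>
    then show ?thesis
      using K(2) k(1) by simp
  qed
  then have "2 * real N / 5 \<le> (real M)\<^sup>2"
    by (simp flip: of_nat_power)
  then show ?thesis
    unfolding M_def by (simp add: real_le_lsqrt)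
qed

end
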